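(* Let $A$ be an $n\times n$ matrix drawn from the GOE with Laplacian matrix $\mathcal{L}_A$. Let $$a_n := \sqrt{2\log n},\qquad b_n' := \sqrt{2\log n}-\frac{\log\log n+\log(4\pi)}{2\sqrt{2\log n}}.$$ Then the centered and rescaled largest diagonal entry of $\mathcal{L}_A$, $$a_n\left(\max_{1\le i\le n}(\mathcal{L}_A)_{ii}-b_n'\right),$$ converges in distribution as $n\to\infty$ to the standard Gumbel distribution.
   Context: An $n\times n$ real symmetric random matrix $A$ is drawn from the Gaussian Orthogonal Ensemble (GOE) if its entries $A_{ij}$, $1\le i\le j\le n$, are independent Gaussian random variables, $A_{ij}$ having mean zero and variance $\frac{1+\delta_{ij}}{n}$ ($\delta_{ij}$ the Kronecker delta). For a real symmetric $n\times n$ matrix $A$, its Laplacian matrix is $\mathcal{L}_A := D_A-A$, where $D_A$ is the diagonal matrix with $(D_A)_{ii}=\sum_{j=1}^n A_{ij}$. The standard Gumbel distribution has cumulative distribution function $F(x)=\exp(-e^{-x})$, $x\in\mathbb{R}$. *)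

theory Defs
  imports "HOL-Probability.Probability" "Jordan_Normal_Form.Matrix"
begin

definition laplacian_mat :: "real mat \<Rightarrow> real mat" where
  "laplacian_mat A =
     mat_diag (dim_row A) (\<lambda>i. \<Sum>j<dim_col A. A $$ (i, j)) - A"

definition max_diag :: "real mat \<Rightarrow> real" where
  "max_diag B = Max ((\<lambda>i. B $$ (i, i)) ` {..<dim_row B})"

text \<open>Matrix indices run over \<open>{0..<n}\<close>. The second parameter of \<^const>\<open>normal_density\<close>
  is the standard deviation, so the entries have variance \<open>2 / n\<close> on the diagonal and
  \<open>1 / n\<close> off the diagonal. Measurability of the entries is part of \<^const>\<open>distributed\<close>.\<close>

definition GOE :: "nat \<Rightarrow> 'a measure \<Rightarrow> ('a \<Rightarrow> real mat) \<Rightarrow> bool" where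
  "GOE n M A \<longleftrightarrow>
     prob_space M \<and>
     (\<forall>\<omega>\<in>space M. A \<omega> \<in> carrier_mat n n \<and> transpose_mat (A \<omega>) = A \<omega>) \<and>
     (\<forall>i j. i \<le> j \<and> j < n \<longrightarrow>
        distributed M lborel (\<lambda>\<omega>. A \<omega> $$ (i, j))
          (normal_density 0 (sqrt ((1 + (if i = j then 1 else 0)) / real n)))) \<and>
     prob_space.indep_vars M (\<lambda>_. borel) (\<lambda>p \<omega>. A \<omega> $$ p) {(i, j). i \<le> j \<and> j < n}"

definition gumbel_cdf :: "real \<Rightarrow> real" where
  "gumbel_cdf x = exp (- exp (- x))"

definition gumbel_distribution :: "real measure" where
  "gumbel_distribution = interval_measure gumbel_cdf"

lemma gumbel_cdf_props:
  shows gumbel_cdf_mono: "x \<le> y \<Longrightarrow> gumbel_cdf x \<le> gumbel_cdf y"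
    and gumbel_cdf_right_cont: "continuous (at_right a) gumbel_cdf"
    and gumbel_cdf_at_bot: "(gumbel_cdf \<longlongrightarrow> 0) at_bot"
    and gumbel_cdf_at_top: "(gumbel_cdf \<longlongrightarrow> 1) at_top"
proof -
  show "x \<le> y \<Longrightarrow> gumbel_cdf x \<le> gumbel_cdf y"
    by (simp add: gumbel_cdf_def)
  show "continuous (at_right a) gumbel_cdf"
    unfolding gumbel_cdf_def by (intro continuous_intros)
  have "filterlim (\<lambda>x::real. exp (- x)) at_top at_bot"
    by (rule filterlim_compose[OF exp_at_top filterlim_uminus_at_top_at_bot])
  then have "filterlim (\<lambda>x::real. - exp (- x)) at_bot at_bot"
    by (simp add: filterlim_uminus_at_top)
  then show "(gumbel_cdf \<longlongrightarrow> 0) at_bot"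
    unfolding gumbel_cdf_def by (rule filterlim_compose[OF exp_at_bot])
  have "((\<lambda>x::real. exp (- x)) \<longlongrightarrow> 0) at_top"
    by (rule filterlim_compose[OF exp_at_bot filterlim_uminus_at_bot_at_top])
  then have "((\<lambda>x::real. exp (- exp (- x))) \<longlongrightarrow> exp (- 0)) at_top"
    by (intro tendsto_intros)
  then show "(gumbel_cdf \<longlongrightarrow> 1) at_top"
    unfolding gumbel_cdf_def by simp
qed

lemma real_distribution_gumbel: "real_distribution gumbel_distribution"
  unfolding gumbel_distribution_def
  by (intro real_distribution_interval_measure gumbel_cdf_props)

lemma cdf_gumbel_distribution: "cdf gumbel_distribution = gumbel_cdf"
  unfolding gumbel_distribution_def
  by (intro cdf_interval_measure gumbel_cdf_props)

definition scale_a :: "nat \<Rightarrow> real" where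
  "scale_a n = sqrt (2 * ln (real n))"

definition centre_b' :: "nat \<Rightarrow> real" where
  "centre_b' n = sqrt (2 * ln (real n))
     - (ln (ln (real n)) + ln (4 * pi)) / (2 * sqrt (2 * ln (real n)))"

end

theory Submission
  imports Defs "HOL-Real_Asymp.Real_Asymp"
begin

text \<open>Only the off-diagonal entries of \<open>A\<close> enter the diagonal \<open>X\<^sub>i\<close> of the Laplacian, and
  \<open>(X\<^sub>i)\<close> is a centred Gaussian vector with covariance \<open>(1 - 2/n) I + (1/n) J\<close>, where \<open>J\<close> is the
  all-ones matrix. Subtracting a suitable multiple \<open>R\<close> of \<open>\<Sum>\<^sub>i X\<^sub>i\<close> removes the correlation, so that
  \<open>X\<^sub>i = sqrt (1 - 2/n) Z\<^sub>i + R\<close> with i.i.d. standard normal \<open>Z\<^sub>i\<close> and \<open>R\<close> of variance \<open>O(1/n)\<close>.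
  Chebyshev gives \<open>\<bar>R\<bar> < n powr (-1/4)\<close> with high probability, and both this shift and the factor
  \<open>sqrt (1 - 2/n)\<close> are negligible at scale \<open>1 / a\<^sub>n\<close>; the limit for the i.i.d. maximum follows from
  the Gaussian tail asymptotics. The independence of the \<open>Z\<^sub>i\<close> is read off their joint characteristic
  function using only the one-dimensional uniqueness theorem.\<close>

section \<open>Gaussian tails\<close>

text \<open>The function \<open>- \<phi>(t) / t\<close> is an antiderivative of \<open>\<phi>(t) (1 + 1 / t\<^sup>2)\<close>.\<close>

lemma std_normal_tail_bounds:
  fixes v :: real
  assumes "v > 0"
  defines "Q \<equiv> measure std_normal_distribution {v<..}"
  shows "Q \<le> std_normal_density v / v"
    and "std_normal_density v / v \<le> (1 + 1 / v\<^sup>2) * Q"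
proof -
  interpret real_distribution std_normal_distribution
    by (rule real_dist_normal_dist)
  let ?\<phi> = std_normal_density
  have Q: "ennreal Q = (\<integral>\<^sup>+t. ennreal (?\<phi> t) * indicator {v..} t \<partial>lborel)"
  proof -
    have "ennreal Q = emeasure std_normal_distribution {v<..}"
      unfolding Q_def by (simp add: emeasure_eq_measure)
    also have "\<dots> = (\<integral>\<^sup>+t. ennreal (?\<phi> t) * indicator {v<..} t \<partial>lborel)"
      by (subst emeasure_density) auto
    also have "\<dots> = (\<integral>\<^sup>+t. ennreal (?\<phi> t) * indicator {v..} t \<partial>lborel)"
      using AE_lborel_singleton[of v]
      by (intro nn_integral_cong_AE) (auto elim!: eventually_mono simp: indicator_def)
    finally show ?thesis .
  qed
  have F: "(\<integral>\<^sup>+t. ennreal (?\<phi> t * (1 + 1 / t\<^sup>2)) * indicator {v..} t \<partial>lborel)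
      = ennreal (0 - (- (?\<phi> v / v)))"
  proof (rule nn_integral_FTC_atLeast)
    fix t assume "v \<le> t"
    with assms have "t > 0" by simp
    then show "((\<lambda>t. - (?\<phi> t / t)) has_real_derivative ?\<phi> t * (1 + 1 / t\<^sup>2)) (at t)"
      unfolding std_normal_density_def
      by (auto intro!: derivative_eq_intros simp: divide_simps)
        (simp add: algebra_simps power2_eq_square)
    show "0 \<le> ?\<phi> t * (1 + 1 / t\<^sup>2)" by simp
  next
    show "((\<lambda>t. - (?\<phi> t / t)) \<longlongrightarrow> 0) at_top"
      unfolding std_normal_density_def by real_asymp
  qed simp
  \<comment> \<open>Dropping the factor 1 + 1/t^2 >= 1 from the integrand in \<open>F\<close> can
    only decrease the integral.\<close>
  have "ennreal Q \<le> ennreal (?\<phi> v / v)"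
    unfolding Q minus_minus diff_0 F[unfolded minus_minus diff_0, symmetric]
    by (intro nn_integral_mono mult_right_mono ennreal_leI) (auto simp: field_simps)
  then show "Q \<le> ?\<phi> v / v"
    using assms by (simp add: ennreal_le_iff)
  \<comment> \<open>For the reverse bound the same factor is at most its value at the left end point
    v, which comes out as a constant.\<close>
  have "ennreal (?\<phi> v / v) \<le> (\<integral>\<^sup>+t. ennreal (1 + 1 / v\<^sup>2) * (ennreal (?\<phi> t) * indicator {v..} t) \<partial>lborel)"
    unfolding F[unfolded minus_minus diff_0, symmetric]
  proof (intro nn_integral_mono)
    fix t :: real
    have "?\<phi> t * (1 + 1 / t\<^sup>2) \<le> (1 + 1 / v\<^sup>2) * ?\<phi> t" if "v \<le> t"
      using that assms by (subst mult.commute)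
        (intro mult_right_mono add_left_mono divide_left_mono power_mono, auto)
    then show "ennreal (?\<phi> t * (1 + 1 / t\<^sup>2)) * indicator {v..} t
        \<le> ennreal (1 + 1 / v\<^sup>2) * (ennreal (?\<phi> t) * indicator {v..} t)"
      by (auto simp: indicator_def ennreal_mult'[symmetric] simp del: ennreal_plus
          intro!: ennreal_leI)
  qed
  also have "\<dots> = ennreal (1 + 1 / v\<^sup>2) * ennreal Q"
    unfolding Q by (rule nn_integral_cmult) simp
  also have "\<dots> = ennreal ((1 + 1 / v\<^sup>2) * Q)"
    by (rule ennreal_mult[symmetric]) (auto simp: Q_def)
  finally show "?\<phi> v / v \<le> (1 + 1 / v\<^sup>2) * Q"
    by (subst (asm) ennreal_le_iff) (auto simp: Q_def)
qed

text \<open>Squeeze by exp (- p / (1 - p)) <= 1 - p <= exp (- p), valid once p < 1, and raise to the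
  n-th power. Convergence of n p forces p to tend to 0, so both exponents tend to -c. The lower
  bound is 1 + y <= exp y at y = p / (1 - p), inverted.\<close>

lemma tendsto_one_minus_power:
  fixes p :: "nat \<Rightarrow> real"
  assumes p: "\<And>n. 0 \<le> p n" and lim: "(\<lambda>n. real n * p n) \<longlonglongrightarrow> c"
  shows "(\<lambda>n. (1 - p n) ^ n) \<longlonglongrightarrow> exp (- c)"
proof (rule tendsto_sandwich)
  have "(\<lambda>n. (real n * p n) * (1 / real n)) \<longlonglongrightarrow> c * 0"
    by (intro tendsto_mult lim lim_1_over_n)
  then have p0: "p \<longlonglongrightarrow> 0"
    by (auto elim!: Lim_transform_eventually intro: eventually_mono[OF eventually_gt_at_top[of 0]])
  have ev: "eventually (\<lambda>n. p n < 1) sequentially"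
    using order_tendstoD(2)[OF p0, of 1] by simp
  show "\<forall>\<^sub>F n in sequentially. (1 - p n) ^ n \<le> exp (- (real n * p n))"
    using ev
  proof eventually_elim
    case (elim n)
    have "(1 - p n) ^ n \<le> exp (- p n) ^ n"
      using elim exp_ge_add_one_self[of "- p n"] by (intro power_mono) auto
    then show ?case by (simp flip: exp_of_nat_mult)
  qed
  show "\<forall>\<^sub>F n in sequentially. exp (- (real n * p n) / (1 - p n)) \<le> (1 - p n) ^ n"
    using ev
  proof eventually_elim
    case (elim n)
    have "1 / (1 - p n) = 1 + p n / (1 - p n)" using elim by (simp add: field_simps)
    also have "\<dots> \<le> exp (p n / (1 - p n))" by (rule exp_ge_add_one_self)
    finally have "exp (- (p n / (1 - p n))) \<le> 1 - p n"
      using elim by (simp add: exp_minus field_simps)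
    then have "exp (- (p n / (1 - p n))) ^ n \<le> (1 - p n) ^ n"
      by (intro power_mono) auto
    then show ?case by (simp flip: exp_of_nat_mult)
  qed
  show "(\<lambda>n. exp (- (real n * p n))) \<longlonglongrightarrow> exp (- c)"
    by (intro tendsto_intros lim)
  have "(\<lambda>n. exp (- (real n * p n) / (1 - p n))) \<longlonglongrightarrow> exp (- c / (1 - 0))"
    by (intro tendsto_intros lim p0) simp
  then show "(\<lambda>n. exp (- (real n * p n) / (1 - p n))) \<longlonglongrightarrow> exp (- c)" by simp
qed

section \<open>The threshold for the i.i.d. maximum and its tail probability\<close>

text \<open>If R were the constant -s n^(-1/4), then a diagonal entry sqrt (1 - 2/n) Z + R lies
  below b_n' + x / a_n exactly when Z lies below this level. The values s = 1 and s = -1 give the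
  upper and the lower estimate.\<close>

definition perturbed_level :: "real \<Rightarrow> real \<Rightarrow> nat \<Rightarrow> real" where
  "perturbed_level s x n =
     (centre_b' n + x / scale_a n + s * real n powr (- 1 / 4)) / sqrt (1 - 2 / real n)"

text \<open>Leading-order growth is all that the factor 1 / v in the tail estimate \<phi>(v) / v
  requires; it also shows that the level tends to infinity.\<close>

lemma perturbed_level_sim: "(\<lambda>n. perturbed_level s x n / sqrt (ln (real n))) \<longlonglongrightarrow> sqrt 2"
  unfolding perturbed_level_def centre_b'_def scale_a_def
  by (real_asymp simp: powr_half_sqrt)



text \<open>Since v^2 / 2 is exponentiated in the Gaussian density, it must be known up to o(1).
  With r = sqrt (2 ln n) the numerator of the level is r - m / (2 r) + e, where m = ln (ln n) + K
  and e is the shift. Half its square is ln n - m / 2 plus terms that vanish, so s leaves no trace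
  in the limit.\<close>

lemma perturbed_level_square:
  "(\<lambda>n. (perturbed_level s x n)\<^sup>2 / 2 - ln (real n) + ln (ln (real n)) / 2) \<longlonglongrightarrow> x - ln (4 * pi) / 2"
proof -
  define K where "K = ln (4 * pi) - 2 * x"
  define l where "l n = ln (real n)" for n
  define e where "e n = s * real n powr (- 1 / 4)" for n
  define m where "m n = ln (l n) + K" for n
  define N where "N n = sqrt (2 * l n) - m n / (2 * sqrt (2 * l n)) + e n" for n
  have level: "perturbed_level s x n = N n / sqrt (1 - 2 / real n)" for n
    unfolding perturbed_level_def N_def m_def l_def e_def K_def centre_b'_def scale_a_def
    by (simp add: diff_divide_distrib add_divide_distrib)
  have 1: "(\<lambda>n. (m n)\<^sup>2 / (16 * l n)) \<longlonglongrightarrow> 0"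
    unfolding m_def l_def by real_asymp
  have 2: "(\<lambda>n. e n * sqrt (2 * l n)) \<longlonglongrightarrow> 0"
    unfolding e_def l_def by real_asymp
  have 3: "(\<lambda>n. e n * m n / (2 * sqrt (2 * l n))) \<longlonglongrightarrow> 0"
    unfolding e_def m_def l_def by real_asymp
  have 4: "(\<lambda>n. (e n)\<^sup>2 / 2) \<longlonglongrightarrow> 0"
  proof -
    have "e \<longlonglongrightarrow> 0" unfolding e_def by real_asymp
    then have "(\<lambda>n. (e n)\<^sup>2 / 2) \<longlonglongrightarrow> 0\<^sup>2 / 2" by (intro tendsto_intros) auto
    then show ?thesis by simp
  qed
  \<comment> \<open>This is the cost of dividing by sqrt (1 - 2/n): half of N^2 / (1 - 2/n) exceeds
    half of N^2 by exactly this expression, and N^2 is only of order ln n.\<close>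
  have 5: "(\<lambda>n. (N n)\<^sup>2 / real n / (1 - 2 / real n)) \<longlonglongrightarrow> 0"
    unfolding N_def e_def m_def l_def by real_asymp
  have "(\<lambda>n. - K / 2 + (m n)\<^sup>2 / (16 * l n) + e n * sqrt (2 * l n)
      - e n * m n / (2 * sqrt (2 * l n)) + (e n)\<^sup>2 / 2 + (N n)\<^sup>2 / real n / (1 - 2 / real n))
      \<longlonglongrightarrow> - K / 2 + 0 + 0 - 0 + 0 + 0"
    by (intro tendsto_intros 1 2 3 4 5)
  moreover have "\<forall>\<^sub>F n in sequentially. - K / 2 + (m n)\<^sup>2 / (16 * l n) + e n * sqrt (2 * l n)
      - e n * m n / (2 * sqrt (2 * l n)) + (e n)\<^sup>2 / 2 + (N n)\<^sup>2 / real n / (1 - 2 / real n)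
      = (perturbed_level s x n)\<^sup>2 / 2 - ln (real n) + ln (ln (real n)) / 2"
    using eventually_gt_at_top[of 2]
  proof eventually_elim
    case (elim n)
    define r where "r = sqrt (2 * l n)"
    \<comment> \<open>Writing \<open>l n\<close> as half of r^2 turns the expansion of the square
      into an identity of rational functions in r.\<close>
    have "l n > 0" using elim by (simp add: l_def)
    then have r: "r > 0" "l n = r\<^sup>2 / 2" by (auto simp: r_def)
    have eq: "(N n)\<^sup>2 / 2 - l n + (m n - K) / 2
        = - K / 2 + (m n)\<^sup>2 / (16 * l n) + e n * r - e n * m n / (2 * r) + (e n)\<^sup>2 / 2"
      unfolding N_def r_def[symmetric] r(2) using r(1)
      by (simp add: field_simps) (simp add: algebra_simps eval_nat_numeral)
    have sq: "(perturbed_level s x n)\<^sup>2 / 2 = (N n)\<^sup>2 / 2 + (N n)\<^sup>2 / real n / (1 - 2 / real n)"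
    proof -
      have "(perturbed_level s x n)\<^sup>2 = (N n)\<^sup>2 / (1 - 2 / real n)"
        using elim by (simp add: level power_divide)
      then show ?thesis using elim by (simp add: field_simps)
    qed
    have "(perturbed_level s x n)\<^sup>2 / 2 - ln (real n) + ln (ln (real n)) / 2
        = ((N n)\<^sup>2 / 2 - l n + (m n - K) / 2) + (N n)\<^sup>2 / real n / (1 - 2 / real n)"
      unfolding sq by (simp add: m_def l_def)
    then show ?case unfolding eq r_def by simp
  qed
  ultimately have "(\<lambda>n. (perturbed_level s x n)\<^sup>2 / 2 - ln (real n) + ln (ln (real n)) / 2)
      \<longlonglongrightarrow> - K / 2 + 0 + 0 - 0 + 0 + 0"
    by (rule Lim_transform_eventually)
  then show ?thesis by (simp add: K_def field_simps)
qed

text \<open>The tail is asymptotic to \<phi>(v) / v. Multiplied by n, this is exp (- (v^2 / 2 - ln n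
  + ln (ln n) / 2)) divided by sqrt (2 pi) times v / sqrt (ln n), and the two preceding lemmas give
  the limit of each factor.\<close>

lemma std_normal_tail_perturbed_level:
  "(\<lambda>n. real n * measure std_normal_distribution {perturbed_level s x n<..}) \<longlonglongrightarrow> exp (- x)"
proof -
  let ?v = "perturbed_level s x"
  let ?Q = "\<lambda>n. measure std_normal_distribution {?v n<..}"
  let ?h = "\<lambda>n. real n * (std_normal_density (?v n) / ?v n)"
  have "filterlim (\<lambda>n. ?v n / sqrt (ln (real n)) * sqrt (ln (real n))) at_top sequentially"
    by (rule filterlim_tendsto_pos_mult_at_top[OF perturbed_level_sim]) (simp, real_asymp)
  then have v_top: "filterlim ?v at_top sequentially"
    by (rule filterlim_mono_eventually)
      (auto intro: eventually_mono[OF eventually_gt_at_top[of 1]])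
  then have v_pos: "\<forall>\<^sub>F n in sequentially. 0 < ?v n"
    by (simp add: filterlim_at_top_dense)
  have "(\<lambda>n. exp (- ((?v n)\<^sup>2 / 2 - ln (real n) + ln (ln (real n)) / 2))
       / (sqrt (2 * pi) * (?v n / sqrt (ln (real n)))))
      \<longlonglongrightarrow> exp (- (x - ln (4 * pi) / 2)) / (sqrt (2 * pi) * sqrt 2)"
    by (intro tendsto_intros perturbed_level_sim perturbed_level_square) simp
  \<comment> \<open>Here the constant ln (4 pi) in the centring pays off: it cancels sqrt (2 pi)
    from the density and sqrt 2 from the growth of the level.\<close>
  moreover have "exp (- (x - ln (4 * pi) / 2)) / (sqrt (2 * pi) * sqrt 2) = exp (- x)"
  proof -
    have "exp (- (x - ln (4 * pi) / 2)) = exp (- x) * exp (ln (4 * pi) / 2)"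
      by (simp flip: exp_add)
    also have "exp (ln (4 * pi) / 2) = sqrt (4 * pi)"
      by (subst powr_half_sqrt[symmetric]) (simp_all add: powr_def)
    also have "sqrt (4 * pi) = sqrt (2 * pi) * sqrt 2"
      by (simp flip: real_sqrt_mult)
    finally show ?thesis by simp
  qed
  moreover have "\<forall>\<^sub>F n in sequentially. exp (- ((?v n)\<^sup>2 / 2 - ln (real n) + ln (ln (real n)) / 2))
       / (sqrt (2 * pi) * (?v n / sqrt (ln (real n)))) = ?h n"
    using v_pos eventually_gt_at_top[of 1]
  proof eventually_elim
    case (elim n)
    have "exp (- ((?v n)\<^sup>2 / 2 - ln (real n) + ln (ln (real n)) / 2))
      = exp (- (?v n)\<^sup>2 / 2) * exp (ln (real n)) / exp (ln (ln (real n)) / 2)"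
      by (simp flip: exp_add exp_diff)
    also have "exp (ln (ln (real n)) / 2) = sqrt (ln (real n))"
      using elim by (simp add: powr_half_sqrt[symmetric] powr_def)
    also have "exp (ln (real n)) = real n"
      using elim by simp
    finally show ?case
      using elim by (simp add: std_normal_density_def field_simps)
  qed
  ultimately have h: "?h \<longlonglongrightarrow> exp (- x)"
    by (auto elim: Lim_transform_eventually)
  have "(\<lambda>n. ?h n / (1 + 1 / (?v n)\<^sup>2)) \<longlonglongrightarrow> exp (- x) / (1 + 0)"
    by (intro tendsto_intros h tendsto_divide_0 filterlim_at_top_imp_at_infinity
        filterlim_pow_at_top v_top) auto
  then have h': "(\<lambda>n. ?h n / (1 + 1 / (?v n)\<^sup>2)) \<longlonglongrightarrow> exp (- x)" by simp
  show ?thesis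
  proof (rule tendsto_sandwich[OF _ _ h' h])
    show "\<forall>\<^sub>F n in sequentially. real n * ?Q n \<le> ?h n"
      using v_pos by eventually_elim (intro mult_left_mono std_normal_tail_bounds, auto)
    show "\<forall>\<^sub>F n in sequentially. ?h n / (1 + 1 / (?v n)\<^sup>2) \<le> real n * ?Q n"
      using v_pos
    proof eventually_elim
      case (elim n)
      have "1 + 1 / (?v n)\<^sup>2 > 0" by (simp add: add_pos_nonneg)
      note pos_divide_le_eq[OF this]
      then show ?case
        using mult_left_mono[OF std_normal_tail_bounds(2)[OF elim], of "real n"]
        by (simp only: mult_ac of_nat_0_le_iff)
    qed
  qed
qed

section \<open>Independence from the joint characteristic function\<close>

context prob_space
begin

text \<open>Tilting the measure by \<open>w\<close> reduces the claim to the uniqueness theorem for characteristic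
  functions; the next two lemmas extend it to real weights by adding a constant and to complex
  weights by splitting into real and imaginary parts.\<close>

lemma expectation_indicator_eq_if_char_nonneg:
  fixes w Y :: "'a \<Rightarrow> real"
  assumes w: "integrable M w" "\<And>\<omega>. 0 \<le> w \<omega>"
    and Y [measurable]: "Y \<in> borel_measurable M"
    and \<mu>: "real_distribution \<mu>"
    and char: "\<And>s. expectation (\<lambda>\<omega>. complex_of_real (w \<omega>) * iexp (s * Y \<omega>)) = expectation w * char \<mu> s"
    and B [measurable]: "B \<in> sets borel"
  shows "expectation (\<lambda>\<omega>. w \<omega> * indicator B (Y \<omega>)) = expectation w * measure \<mu> B"
proof (cases "expectation w = 0")
  \<comment> \<open>The tilted measure has density w divided by its mean. A zero mean excludes this,
    but then w vanishes almost everywhere and both sides are 0.\<close>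
  case True
  then have "AE \<omega> in M. w \<omega> = 0"
    using integral_nonneg_eq_0_iff_AE[OF w(1)] w(2) by simp
  then have "expectation (\<lambda>\<omega>. w \<omega> * indicator B (Y \<omega>)) = expectation (\<lambda>_. 0)"
    using borel_measurable_integrable[OF w(1)]
    by (intro integral_cong_AE) auto
  with True show ?thesis by simp
next
  case False
  define m where "m = expectation w"
  have m: "m > 0" using False Bochner_Integration.integral_nonneg[of M w] w(2) by (simp add: m_def less_le)
  have [measurable]: "w \<in> borel_measurable M"
    using w(1) by auto
  define D where "D = density M (\<lambda>\<omega>. w \<omega> / m)"
  define \<nu> where "\<nu> = distr D borel Y"
  have [measurable]: "Y \<in> borel_measurable D" by (simp add: D_def)
  have "emeasure D (space D) = (\<integral>\<^sup>+\<omega>. ennreal (w \<omega> / m) \<partial>M)"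
    unfolding D_def by (subst emeasure_density) (auto cong: nn_integral_cong)
  also have "\<dots> = ennreal (expectation w / m)"
    using nn_integral_eq_integral[of M "\<lambda>\<omega>. w \<omega> / m"] w m by simp
  also have "\<dots> = 1" using m by (simp add: m_def)
  finally interpret D: prob_space D by (intro prob_spaceI)
  interpret \<mu>: real_distribution \<mu> by fact
  have \<nu>: "real_distribution \<nu>"
    unfolding \<nu>_def by (rule D.real_distribution_distr) simp
  then interpret \<nu>: real_distribution \<nu> .
  have "char \<nu> s = char \<mu> s" for s
  proof -
    have "char \<nu> s = (LINT \<omega>|D. iexp (s * Y \<omega>))"
      unfolding char_def \<nu>_def by (subst integral_distr) auto
    also have "\<dots> = expectation (\<lambda>\<omega>. (w \<omega> / m) *\<^sub>R iexp (s * Y \<omega>))"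
      unfolding D_def using w m by (subst integral_density) auto
    also have "\<dots> = expectation (\<lambda>\<omega>. complex_of_real (w \<omega>) * iexp (s * Y \<omega>)) / m"
      by (subst integral_divide_zero[symmetric]) (simp add: scaleR_conv_of_real)
    also have "\<dots> = char \<mu> s"
      unfolding char m_def[symmetric] using m by simp
    finally show ?thesis .
  qed
  then have "\<nu> = \<mu>" by (intro Levy_uniqueness \<nu> \<mu>) auto
  have "measure \<nu> B = measure D (Y -` B \<inter> space D)"
    unfolding \<nu>_def by (rule measure_distr) auto
  also have "\<dots> = (LINT \<omega>|D. indicator (Y -` B \<inter> space D) \<omega>)"
    by simp
  also have "\<dots> = (LINT \<omega>|D. indicator B (Y \<omega>))"
    by (intro Bochner_Integration.integral_cong) (auto simp: indicator_def)
  also have "\<dots> = expectation (\<lambda>\<omega>. (w \<omega> / m) *\<^sub>R indicator B (Y \<omega>))"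
    unfolding D_def using w m by (subst integral_density) auto
  also have "\<dots> = expectation (\<lambda>\<omega>. w \<omega> * indicator B (Y \<omega>)) / m"
    by (subst integral_divide_zero[symmetric]) simp
  finally show ?thesis using m \<open>\<nu> = \<mu>\<close> by (simp add: m_def field_simps)
qed

lemma integrable_complex_times_iexp:
  assumes "integrable M w" and [measurable]: "Y \<in> borel_measurable M"
  shows "integrable M (\<lambda>\<omega>. w \<omega> * iexp (s * Y \<omega>))"
  using assms(1)
proof (rule Bochner_Integration.integrable_bound)
  note borel_measurable_integrable[OF assms(1), measurable]
  show "(\<lambda>\<omega>. w \<omega> * iexp (s * Y \<omega>)) \<in> borel_measurable M" by measurable
qed (simp add: norm_mult)

lemma expectation_indicator_eq_if_char_real:
  fixes w Y :: "'a \<Rightarrow> real"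
  assumes w [measurable]: "w \<in> borel_measurable M" and C: "\<And>\<omega>. \<bar>w \<omega>\<bar> \<le> C"
    and Y [measurable]: "Y \<in> borel_measurable M"
    and \<mu>: "real_distribution \<mu>"
    and char0: "char (distr M borel Y) = char \<mu>"
    and char: "\<And>s. expectation (\<lambda>\<omega>. complex_of_real (w \<omega>) * iexp (s * Y \<omega>)) = expectation w * char \<mu> s"
    and B [measurable]: "B \<in> sets borel"
  shows "expectation (\<lambda>\<omega>. w \<omega> * indicator B (Y \<omega>)) = expectation w * measure \<mu> B"
proof -
  have int: "integrable M w"
    by (rule integrable_const_bound[of _ C]) (use C in auto)
  have intB: "integrable M (\<lambda>\<omega>. indicator B (Y \<omega>) :: real)"
    by (rule integrable_const_bound[of _ 1]) (auto simp: indicator_def)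
  have intwB: "integrable M (\<lambda>\<omega>. w \<omega> * indicator B (Y \<omega>))"
    by (rule Bochner_Integration.integrable_bound[OF int]) (auto simp: indicator_def)
  have E: "expectation (\<lambda>\<omega>. iexp (s * Y \<omega>)) = char \<mu> s" for s
    using char0[symmetric] by (simp add: char_def integral_distr)
  have 1: "expectation (\<lambda>\<omega>. indicator B (Y \<omega>)) = measure \<mu> B"
    using expectation_indicator_eq_if_char_nonneg[of "\<lambda>_. 1" Y \<mu> B] E \<mu>
    by (simp add: prob_space)
  \<comment> \<open>The shifted weight is nonnegative, and its Fourier identity splits into the
    hypothesis for w and C times the identity \<open>E\<close> for the constant weight. Subtracting
    the contribution of C afterwards recovers w.\<close>
  have "expectation (\<lambda>\<omega>. (w \<omega> + C) * indicator B (Y \<omega>)) = expectation (\<lambda>\<omega>. w \<omega> + C) * measure \<mu> B"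
  proof (rule expectation_indicator_eq_if_char_nonneg)
    show "0 \<le> w \<omega> + C" for \<omega> using C[of \<omega>] by linarith
    fix s
    have "expectation (\<lambda>\<omega>. complex_of_real (w \<omega> + C) * iexp (s * Y \<omega>))
      = expectation (\<lambda>\<omega>. complex_of_real (w \<omega>) * iexp (s * Y \<omega>) + C * iexp (s * Y \<omega>))"
      by (simp add: algebra_simps)
    also have "\<dots> = expectation (\<lambda>\<omega>. complex_of_real (w \<omega>) * iexp (s * Y \<omega>))
        + C * expectation (\<lambda>\<omega>. iexp (s * Y \<omega>))"
      by (subst Bochner_Integration.integral_add)
        (use int integrable_complex_times_iexp[of "\<lambda>_. C" Y s]
          integrable_complex_times_iexp[of "\<lambda>\<omega>. complex_of_real (w \<omega>)" Y s] in auto)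
    also have "\<dots> = expectation w * char \<mu> s + C * char \<mu> s"
      unfolding char E ..
    finally show "expectation (\<lambda>\<omega>. complex_of_real (w \<omega> + C) * iexp (s * Y \<omega>))
        = expectation (\<lambda>\<omega>. w \<omega> + C) * char \<mu> s"
      using int by (simp add: algebra_simps prob_space)
  qed (use int \<mu> in auto)
  moreover have "expectation (\<lambda>\<omega>. (w \<omega> + C) * indicator B (Y \<omega>))
      = expectation (\<lambda>\<omega>. w \<omega> * indicator B (Y \<omega>)) + C * measure \<mu> B"
    using intB intwB by (simp add: distrib_right 1)
  ultimately show ?thesis
    using int by (simp add: distrib_right prob_space)
qed

lemma expectation_indicator_eq_if_char:
  fixes w :: "'a \<Rightarrow> complex" and Y :: "'a \<Rightarrow> real"
  assumes w [measurable]: "w \<in> borel_measurable M" and C: "\<And>\<omega>. norm (w \<omega>) \<le> C"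
    and Y [measurable]: "Y \<in> borel_measurable M"
    and \<mu>: "real_distribution \<mu>"
    and char0: "char (distr M borel Y) = char \<mu>"
    and char: "\<And>s. expectation (\<lambda>\<omega>. w \<omega> * iexp (s * Y \<omega>)) = expectation w * char \<mu> s"
    and B [measurable]: "B \<in> sets borel"
  shows "expectation (\<lambda>\<omega>. w \<omega> * indicator B (Y \<omega>)) = expectation w * measure \<mu> B"
proof -
  \<comment> \<open>Stated for a general u so that it serves twice: u = w gives the real part, and u
    = -i w has real part Im w.\<close>
  have real_part: "expectation (\<lambda>\<omega>. Re (u \<omega>) * indicator B (Y \<omega>)) = Re (expectation u) * measure \<mu> B"
    if u [measurable]: "u \<in> borel_measurable M" and uC: "\<And>\<omega>. norm (u \<omega>) \<le> C"
      and uchar: "\<And>s. expectation (\<lambda>\<omega>. u \<omega> * iexp (s * Y \<omega>)) = expectation u * char \<mu> s"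
    for u
  proof -
    have int: "integrable M u"
      by (rule integrable_const_bound[of _ C]) (use uC in auto)
    have "expectation (\<lambda>\<omega>. Re (u \<omega>) * indicator B (Y \<omega>)) = expectation (\<lambda>\<omega>. Re (u \<omega>)) * measure \<mu> B"
    proof (rule expectation_indicator_eq_if_char_real[OF _ _ Y \<mu> char0 _ B])
      show "\<bar>Re (u \<omega>)\<bar> \<le> C" for \<omega>
        using abs_Re_le_cmod[of "u \<omega>"] uC[of \<omega>] by linarith
      fix s
      \<comment> \<open>Re u is the mean of u and its conjugate, and conjugation reverses the
        frequency. The hypothesis at -s therefore handles the conjugate half.\<close>
      have char_neg: "char \<mu> (- s) = cnj (char \<mu> s)"
      proof -
        have "char \<mu> (- s) = (CLINT x|\<mu>. cnj (iexp (s * x)))"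
          by (simp add: char_def exp_cnj)
        then show ?thesis by (simp only: char_def Bochner_Integration.integral_cnj)
      qed
      have "expectation (\<lambda>\<omega>. complex_of_real (Re (u \<omega>)) * iexp (s * Y \<omega>))
        = expectation (\<lambda>\<omega>. (u \<omega> * iexp (s * Y \<omega>) + cnj (u \<omega> * iexp ((- s) * Y \<omega>))) / 2)"
        by (intro Bochner_Integration.integral_cong)
          (auto simp: complex_add_cnj[symmetric] complex_eq_iff exp_cnj field_simps)
      also have "\<dots> = (expectation (\<lambda>\<omega>. u \<omega> * iexp (s * Y \<omega>))
          + cnj (expectation (\<lambda>\<omega>. u \<omega> * iexp ((- s) * Y \<omega>)))) / 2"
        using integrable_complex_times_iexp[OF int Y, of s]
          integrable_complex_times_iexp[OF int Y, of "- s"]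
        by (subst integral_divide_zero, subst Bochner_Integration.integral_add)
          (simp_all only: Bochner_Integration.integral_cnj integrable_cnj)
      also have "\<dots> = (expectation u + cnj (expectation u)) / 2 * char \<mu> s"
        unfolding uchar char_neg by (simp add: field_simps)
      also have "(expectation u + cnj (expectation u)) / 2 = expectation (\<lambda>\<omega>. Re (u \<omega>))"
        using int by (simp add: complex_add_cnj)
      finally show "expectation (\<lambda>\<omega>. complex_of_real (Re (u \<omega>)) * iexp (s * Y \<omega>))
          = expectation (\<lambda>\<omega>. Re (u \<omega>)) * char \<mu> s" .
    qed simp
    with int show ?thesis by simp
  qed
  have Re_ind: "Re (z * indicator B y) = Re z * indicator B y"
    and Im_ind: "Im (z * indicator B y) = Im z * indicator B y" for z y
    by (simp_all add: indicator_def)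
  have "integrable M w"
    by (rule integrable_const_bound[of _ C]) (use C in auto)
  then have "integrable M (\<lambda>\<omega>. w \<omega> * indicator B (Y \<omega>))"
    by (rule Bochner_Integration.integrable_bound) (auto simp: indicator_def)
  then have int: "Re (expectation (\<lambda>\<omega>. w \<omega> * indicator B (Y \<omega>)))
        = expectation (\<lambda>\<omega>. Re (w \<omega>) * indicator B (Y \<omega>))"
      "Im (expectation (\<lambda>\<omega>. w \<omega> * indicator B (Y \<omega>)))
        = expectation (\<lambda>\<omega>. Im (w \<omega>) * indicator B (Y \<omega>))"
    by (simp_all only: integral_Re[symmetric] integral_Im[symmetric] Re_ind Im_ind)
  have "expectation (\<lambda>\<omega>. Im (w \<omega>) * indicator B (Y \<omega>)) = Im (expectation w) * measure \<mu> B"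
    using real_part[of "\<lambda>\<omega>. - \<i> * w \<omega>"] C char by (simp add: norm_mult mult.assoc)
  with real_part[OF w C char] int show ?thesis
    by (simp add: complex_eq_iff)
qed

text \<open>The claim \<open>partial\<close> interpolates between the two sides: at J = {} it is the
  hypothesis on the joint characteristic function, at J = I it is the product formula for the
  probability.\<close>

lemma prob_prod_if_char_prod:
  fixes Y :: "'i \<Rightarrow> 'a \<Rightarrow> real"
  assumes I: "finite I"
    and Y [measurable]: "\<And>i. i \<in> I \<Longrightarrow> Y i \<in> borel_measurable M"
    and \<mu>: "\<And>i. i \<in> I \<Longrightarrow> real_distribution (\<mu> i)"
    and char: "\<And>t. expectation (\<lambda>\<omega>. iexp (\<Sum>i\<in>I. t i * Y i \<omega>)) = (\<Prod>i\<in>I. char (\<mu> i) (t i))"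
    and B [measurable]: "\<And>i. i \<in> I \<Longrightarrow> B i \<in> sets borel"
  shows "prob {\<omega> \<in> space M. \<forall>i\<in>I. Y i \<omega> \<in> B i} = (\<Prod>i\<in>I. measure (\<mu> i) (B i))"
proof -
  \<comment> \<open>Fourier modes are replaced by indicators one coordinate at a time.\<close>
  have partial: "expectation (\<lambda>\<omega>. (\<Prod>j\<in>J. indicator (B j) (Y j \<omega>)) * iexp (\<Sum>i\<in>I - J. t i * Y i \<omega>))
      = complex_of_real (\<Prod>j\<in>J. measure (\<mu> j) (B j)) * (\<Prod>i\<in>I - J. char (\<mu> i) (t i))"
    if "J \<subseteq> I" for J t
    using finite_subset[OF that I] that
  proof (induction J arbitrary: t rule: finite_induct)
    case empty
    then show ?case using char[of t] by simp
  next
    case (insert a J)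
    define K where "K = I - insert a J"
    have K: "I - J = insert a K" "a \<notin> K" "finite K" "K \<subseteq> I" "a \<in> I" "J \<subseteq> I"
      using insert.prems insert.hyps I by (auto simp: K_def)
    interpret \<mu>: real_distribution "\<mu> a" using \<mu> K by auto
    \<comment> \<open>The weight collects every coordinate except a: indicators for those already
      treated, Fourier modes for those still to come. The frequency of coordinate a is left free, as
      one-dimensional uniqueness requires.\<close>
    define w where "w \<omega> = (\<Prod>j\<in>J. indicator (B j) (Y j \<omega>)) * iexp (\<Sum>i\<in>K. t i * Y i \<omega>)" for \<omega>
    have [measurable]: "Y i \<in> borel_measurable M" "B i \<in> sets borel" if "i \<in> insert a (J \<union> K)" for i
      using that K Y B by auto
    have w [measurable]: "w \<in> borel_measurable M"
      unfolding w_def by measurable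
    have IH: "expectation (\<lambda>\<omega>. w \<omega> * iexp (s * Y a \<omega>))
       = complex_of_real (\<Prod>j\<in>J. measure (\<mu> j) (B j)) * (char (\<mu> a) s * (\<Prod>i\<in>K. char (\<mu> i) (t i)))" for s
    proof -
      have "w \<omega> * iexp (s * Y a \<omega>) = (\<Prod>j\<in>J. indicator (B j) (Y j \<omega>)) *
          iexp (\<Sum>i\<in>I - J. (t(a := s)) i * Y i \<omega>)" for \<omega>
      proof -
        have "(\<Sum>i\<in>K. (t(a := s)) i * Y i \<omega>) = (\<Sum>i\<in>K. t i * Y i \<omega>)"
          using K by (intro sum.cong) auto
        then show ?thesis
          using K by (simp add: w_def exp_add distrib_left)
      qed
      moreover have "(\<Prod>i\<in>K. char (\<mu> i) ((t(a := s)) i)) = (\<Prod>i\<in>K. char (\<mu> i) (t i))"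
        using K by (intro prod.cong) auto
      ultimately show ?thesis
        using insert.IH[of "t(a := s)"] K by simp
    qed
    \<comment> \<open>At frequency s = 0 the factor of coordinate a is 1, which isolates the mean of
      w.\<close>
    have Ew: "expectation w = complex_of_real (\<Prod>j\<in>J. measure (\<mu> j) (B j)) * (\<Prod>i\<in>K. char (\<mu> i) (t i))"
      using IH[of 0] by (simp add: \<mu>.char_zero)
    \<comment> \<open>The marginal law of \<open>Y a\<close> is read off the joint characteristic
      function at frequencies that vanish off a.\<close>
    have char_a: "char (distr M borel (Y a)) = char (\<mu> a)"
    proof
      fix s
      have "(\<Sum>i\<in>I. (if i = a then s else 0) * Y i \<omega>) = s * Y a \<omega>" for \<omega>
        using I K by (subst sum.remove[of _ a]) auto
      moreover have "(\<Prod>i\<in>I. char (\<mu> i) (if i = a then s else 0)) = char (\<mu> a) s"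
        using I K \<mu> by (subst prod.remove[of _ a])
          (auto intro!: prod.neutral simp: real_distribution.char_zero)
      ultimately show "char (distr M borel (Y a)) s = char (\<mu> a) s"
        using char[of "\<lambda>i. if i = a then s else 0"] by (simp add: char_def integral_distr)
    qed
    have "expectation (\<lambda>\<omega>. w \<omega> * indicator (B a) (Y a \<omega>)) = expectation w * measure (\<mu> a) (B a)"
    proof (rule expectation_indicator_eq_if_char[where C = 1, OF w])
      show "norm (w \<omega>) \<le> 1" for \<omega>
        by (auto simp: w_def norm_mult indicator_def prod_norm[symmetric] intro!: prod_le_1)
      show "expectation (\<lambda>\<omega>. w \<omega> * iexp (s * Y a \<omega>)) = expectation w * char (\<mu> a) s" for s
        unfolding IH Ew by simp
    qed (use char_a K \<mu> in auto)
    then show ?case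
      unfolding Ew using insert.hyps
      by (simp add: w_def K_def[symmetric] mult_ac)
  qed
  have "{\<omega> \<in> space M. \<forall>i\<in>I. Y i \<omega> \<in> B i} \<in> events"
    using I by measurable
  then have "complex_of_real (prob {\<omega> \<in> space M. \<forall>i\<in>I. Y i \<omega> \<in> B i})
    = expectation (\<lambda>\<omega>. complex_of_real (indicator {\<omega> \<in> space M. \<forall>i\<in>I. Y i \<omega> \<in> B i} \<omega>))"
    by simp
  also have "\<dots> = expectation (\<lambda>\<omega>. \<Prod>i\<in>I. indicator (B i) (Y i \<omega>))"
    using I by (intro Bochner_Integration.integral_cong)
      (auto simp: indicator_def prod_zero_iff intro!: prod.neutral[symmetric])
  also have "\<dots> = complex_of_real (\<Prod>i\<in>I. measure (\<mu> i) (B i))"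
    using partial[of I] by simp
  finally show ?thesis by (simp only: of_real_eq_iff)
qed

end

section \<open>The diagonal of the Laplacian\<close>

lemma std_normal_chebyshev:
  assumes "a > 0"
  shows "measure std_normal_distribution {x. a \<le> \<bar>x\<bar>} \<le> 1 / a\<^sup>2"
proof -
  interpret real_distribution std_normal_distribution
    by (rule real_dist_normal_dist)
  have 1: "expectation (\<lambda>x. x) = 0"
    using integral_std_normal_distribution_moment_odd[of 1] by simp
  have 2: "expectation (\<lambda>x. x\<^sup>2) = 1" "integrable std_normal_distribution (\<lambda>x. x\<^sup>2)"
    using std_normal_distribution_even_moments[of 1] by simp_all
  show ?thesis
    using Chebyshev_inequality[of "\<lambda>x. x" a] 2 assms unfolding 1 by simp
qed

section \<open>Sums over pairs of indices and the diagonal as a linear form in the matrix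
  entries\<close>

text \<open>Passing from n to n + 1 adds one row and one column, that is, the pairs (i, n) with i <
  n in both orders. This moves sums over the whole matrix to the strict upper triangle, where the
  entries of the GOE are independent.\<close>

lemma sum_off_diagonal:
  fixes f :: "nat \<Rightarrow> nat \<Rightarrow> real"
  shows "(\<Sum>i<n. (\<Sum>j<n. f i j) - f i i) = (\<Sum>(i, j)\<in>{(i, j). i < j \<and> j < n}. f i j + f j i)"
proof (induction n)
  case (Suc n)
  have split: "{(i, j). i < j \<and> j < Suc n} = {(i, j). i < j \<and> j < n} \<union> (\<lambda>i. (i, n)) ` {..<n}"
    by (auto simp: less_Suc_eq)
  have fin: "finite {(i, j). i < j \<and> j < n}"
    by (rule finite_subset[of _ "{..<n} \<times> {..<n}"]) auto
  have "(\<Sum>(i, j)\<in>{(i, j). i < j \<and> j < Suc n}. f i j + f j i)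
      = (\<Sum>(i, j)\<in>{(i, j). i < j \<and> j < n}. f i j + f j i) + (\<Sum>i<n. f i n + f n i)"
    unfolding split using fin
    by (subst sum.union_disjoint) (auto simp: sum.reindex inj_on_def)
  with Suc show ?case by (simp add: sum.distrib sum_subtractf)
qed simp

text \<open>The right-hand side is n times the quadratic form of the covariance (1 - 2/n) I + (1/n)
  J, so this identity computes the variance of a linear form in the Laplacian diagonal.\<close>

lemma sum_pairs_square:
  fixes s :: "nat \<Rightarrow> real"
  shows "(\<Sum>(i, j)\<in>{(i, j). i < j \<and> j < n}. (s i + s j)\<^sup>2)
    = (real n - 2) * (\<Sum>i<n. (s i)\<^sup>2) + (\<Sum>i<n. s i)\<^sup>2"
proof -
  define T U where "T = (\<Sum>i<n. s i)" and "U = (\<Sum>i<n. (s i)\<^sup>2)"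
  \<comment> \<open>The summand is halved because \<open>sum_off_diagonal\<close> counts each
    unordered pair in both orders.\<close>
  have "(\<Sum>(i, j)\<in>{(i, j). i < j \<and> j < n}. (s i + s j)\<^sup>2)
      = (\<Sum>i<n. (\<Sum>j<n. (s i + s j)\<^sup>2 / 2) - (s i + s i)\<^sup>2 / 2)"
    unfolding sum_off_diagonal[of "\<lambda>i j. (s i + s j)\<^sup>2 / 2" n]
    by (intro sum.cong) (auto simp: add.commute)
  also have "\<dots> = (\<Sum>i<n. (real n / 2 - 2) * (s i)\<^sup>2 + s i * T + U / 2)"
    unfolding T_def U_def
    by (intro sum.cong refl)
      (simp add: power2_sum sum.distrib add_divide_distrib sum_distrib_left
        sum_divide_distrib[symmetric] algebra_simps power2_eq_square)
  also have "\<dots> = (real n / 2 - 2) * U + T * T + real n * (U / 2)"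
    by (simp add: T_def U_def sum.distrib flip: sum_distrib_left sum_distrib_right)
  also have "\<dots> = (real n - 2) * U + T\<^sup>2"
    by (simp add: power2_eq_square algebra_simps)
  finally show ?thesis by (simp only: T_def U_def)
qed

lemma laplacian_mat_diag:
  assumes "B \<in> carrier_mat n n" "i < n"
  shows "laplacian_mat B $$ (i, i) = (\<Sum>j<n. B $$ (i, j)) - B $$ (i, i)"
  using assms by (auto simp: laplacian_mat_def mat_diag_def)

lemma max_diag_laplacian_le_iff:
  assumes "B \<in> carrier_mat n n" "n > 0"
  shows "max_diag (laplacian_mat B) \<le> u \<longleftrightarrow> (\<forall>i<n. laplacian_mat B $$ (i, i) \<le> u)"
proof -
  have "dim_row (laplacian_mat B) = n"
    using assms by (simp add: laplacian_mat_def)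
  then show ?thesis
    using assms unfolding max_diag_def by (subst Max_le_iff) auto
qed

text \<open>By symmetry the entry at (i, j) with i < j contributes to the row sums of both i and j,
  hence the coefficient s i + s j; the diagonal entries cancel.\<close>

lemma sum_laplacian_diag:
  assumes B: "B \<in> carrier_mat n n" "transpose_mat B = B"
  shows "(\<Sum>i<n. s i * laplacian_mat B $$ (i, i))
    = (\<Sum>p\<in>{(i, j). i < j \<and> j < n}. (s (fst p) + s (snd p)) * B $$ p)"
proof -
  have sym: "B $$ (j, i) = B $$ (i, j)" if "i < n" "j < n" for i j
    using B that by (metis carrier_matD index_transpose_mat(1))
  have "(\<Sum>i<n. s i * laplacian_mat B $$ (i, i))
      = (\<Sum>i<n. (\<Sum>j<n. s i * B $$ (i, j)) - s i * B $$ (i, i))"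
    using B by (intro sum.cong) (auto simp: laplacian_mat_diag right_diff_distrib sum_distrib_left)
  also have "\<dots> = (\<Sum>(i, j)\<in>{(i, j). i < j \<and> j < n}. s i * B $$ (i, j) + s j * B $$ (j, i))"
    by (rule sum_off_diagonal)
  also have "\<dots> = (\<Sum>p\<in>{(i, j). i < j \<and> j < n}. (s (fst p) + s (snd p)) * B $$ p)"
    by (intro sum.cong) (auto simp: sym distrib_right)
  finally show ?thesis .
qed

section \<open>The joint characteristic function of the Laplacian diagonal\<close>

context prob_space
begin

lemma expectation_iexp_normal:
  assumes "distributed M lborel X (normal_density 0 \<sigma>)" "\<sigma> > 0"
  shows "expectation (\<lambda>\<omega>. iexp (t * X \<omega>)) = exp (- (t * \<sigma>)\<^sup>2 / 2)"
proof -
  have X: "distributed M lborel (\<lambda>\<omega>. X \<omega> / \<sigma>) std_normal_density"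
    using assms normal_standard_normal_convert[of \<sigma> X 0] by simp
  then have [measurable]: "(\<lambda>\<omega>. X \<omega> / \<sigma>) \<in> borel_measurable M"
    by (simp add: distributed_def)
  have "distr M borel (\<lambda>\<omega>. X \<omega> / \<sigma>) = std_normal_distribution"
    using distributed_distr_eq_density[OF X] by (simp cong: distr_cong)
  then have "char (distr M borel (\<lambda>\<omega>. X \<omega> / \<sigma>)) (t * \<sigma>) = exp (- (t * \<sigma>)\<^sup>2 / 2)"
    by (simp add: char_std_normal_distribution)
  moreover have "char (distr M borel (\<lambda>\<omega>. X \<omega> / \<sigma>)) (t * \<sigma>) = expectation (\<lambda>\<omega>. iexp (t * X \<omega>))"
    unfolding char_def using assms(2) by (subst integral_distr) auto
  ultimately show ?thesis by simp
qed

lemma expectation_iexp_sum_indep_normal: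
  assumes "finite P" and indep: "indep_vars (\<lambda>_. borel) X P"
    and normal: "\<And>p. p \<in> P \<Longrightarrow> distributed M lborel (X p) (normal_density 0 \<sigma>)" and "\<sigma> > 0"
  shows "expectation (\<lambda>\<omega>. iexp (\<Sum>p\<in>P. c p * X p \<omega>)) = exp (- (\<sigma>\<^sup>2 * (\<Sum>p\<in>P. (c p)\<^sup>2)) / 2)"
proof -
  have X [measurable]: "X p \<in> borel_measurable M" if "p \<in> P" for p
    using indep that by (auto simp: indep_vars_def)
  have "indep_vars (\<lambda>_. borel) (\<lambda>p \<omega>. c p * X p \<omega>) P"
    by (rule indep_vars_compose2[OF indep]) simp
  from char_distr_sum[OF this, of 1]
  have "expectation (\<lambda>\<omega>. iexp (\<Sum>p\<in>P. c p * X p \<omega>)) = (\<Prod>p\<in>P. expectation (\<lambda>\<omega>. iexp (c p * X p \<omega>)))"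
    unfolding char_def by (simp add: integral_distr cong: prod.cong)
  also have "\<dots> = (\<Prod>p\<in>P. complex_of_real (exp (- (c p * \<sigma>)\<^sup>2 / 2)))"
    using assms by (intro prod.cong refl expectation_iexp_normal) auto
  also have "\<dots> = exp (\<Sum>p\<in>P. - (c p * \<sigma>)\<^sup>2 / 2)"
    using \<open>finite P\<close> by (simp add: exp_sum)
  also have "(\<Sum>p\<in>P. - (c p * \<sigma>)\<^sup>2 / 2) = - (\<sigma>\<^sup>2 * (\<Sum>p\<in>P. (c p)\<^sup>2)) / 2"
    by (simp add: sum_negf sum_divide_distrib sum_distrib_left power_mult_distrib mult.commute)
  finally show ?thesis .
qed

text \<open>The linear form is a combination of independent normal entries of variance 1/n with
  coefficients s i + s j. Its variance is thus the sum from \<open>sum_pairs_square\<close> divided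
  by n.\<close>

lemma expectation_iexp_laplacian_diag:
  assumes GOE: "GOE n M A" and "n > 0"
  shows "expectation (\<lambda>\<omega>. iexp (\<Sum>i<n. s i * laplacian_mat (A \<omega>) $$ (i, i)))
    = exp (- ((real n - 2) * (\<Sum>i<n. (s i)\<^sup>2) + (\<Sum>i<n. s i)\<^sup>2) / (2 * real n))"
proof -
  define P where "P = {(i::nat, j). i < j \<and> j < n}"
  have fin: "finite P"
    unfolding P_def by (rule finite_subset[of _ "{..<n} \<times> {..<n}"]) auto
  have variance: "- ((sqrt (1 / real n))\<^sup>2 * Q) / 2 = - Q / (2 * real n)" for Q
    by (simp add: field_simps)
  have "indep_vars (\<lambda>_. borel) (\<lambda>p \<omega>. A \<omega> $$ p) P"
    by (rule indep_vars_subset[of _ _ "{(i, j). i \<le> j \<and> j < n}"])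
      (use GOE in \<open>auto simp: GOE_def P_def\<close>)
  moreover have "distributed M lborel (\<lambda>\<omega>. A \<omega> $$ p) (normal_density 0 (sqrt (1 / real n)))" if "p \<in> P" for p
  proof -
    obtain i j where p: "p = (i, j)" by (cases p)
    with that have ij: "i < j" "j < n" by (auto simp: P_def)
    have "\<forall>i j. i \<le> j \<and> j < n \<longrightarrow> distributed M lborel (\<lambda>\<omega>. A \<omega> $$ (i, j))
          (normal_density 0 (sqrt ((1 + (if i = j then 1 else 0)) / real n)))"
      using GOE by (simp add: GOE_def)
    from this[rule_format, of i j] p ij show ?thesis by simp
  qed
  ultimately have "expectation (\<lambda>\<omega>. iexp (\<Sum>p\<in>P. (s (fst p) + s (snd p)) * A \<omega> $$ p))
      = exp (- ((sqrt (1 / real n))\<^sup>2 * (\<Sum>p\<in>P. (s (fst p) + s (snd p))\<^sup>2)) / 2)"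
    using fin \<open>n > 0\<close> by (intro expectation_iexp_sum_indep_normal) auto
  also have "(\<Sum>p\<in>P. (s (fst p) + s (snd p))\<^sup>2) = (real n - 2) * (\<Sum>i<n. (s i)\<^sup>2) + (\<Sum>i<n. s i)\<^sup>2"
    using sum_pairs_square[of s n] by (simp add: P_def case_prod_unfold)
  also have "expectation (\<lambda>\<omega>. iexp (\<Sum>p\<in>P. (s (fst p) + s (snd p)) * A \<omega> $$ p))
      = expectation (\<lambda>\<omega>. iexp (\<Sum>i<n. s i * laplacian_mat (A \<omega>) $$ (i, i)))"
    using GOE by (intro Bochner_Integration.integral_cong refl)
      (simp add: GOE_def sum_laplacian_diag P_def)
  also have "- ((sqrt (1 / real n))\<^sup>2 * ((real n - 2) * (\<Sum>i<n. (s i)\<^sup>2) + (\<Sum>i<n. s i)\<^sup>2)) / 2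
      = - ((real n - 2) * (\<Sum>i<n. (s i)\<^sup>2) + (\<Sum>i<n. s i)\<^sup>2) / (2 * real n)"
    by (rule variance)
  finally show ?thesis .
qed

lemma measurable_laplacian_diag:
  assumes GOE: "GOE n M A" and "i < n"
  shows "(\<lambda>\<omega>. laplacian_mat (A \<omega>) $$ (i, i)) \<in> borel_measurable M"
proof -
  have upper: "(\<lambda>\<omega>. A \<omega> $$ (i, j)) \<in> borel_measurable M" if "i \<le> j" "j < n" for i j
    using GOE that by (auto simp: GOE_def distributed_def)
  have [measurable]: "(\<lambda>\<omega>. A \<omega> $$ (i, j)) \<in> borel_measurable M" if "j < n" for j
  proof (cases "i \<le> j")
    case False
    \<comment> \<open>\<open>GOE\<close> gives measurability only on and above the diagonal; below
      it, the pointwise symmetry on the space transfers it.\<close>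
    have "A \<omega> $$ (i, j) = A \<omega> $$ (j, i)" if "\<omega> \<in> space M" for \<omega>
      using GOE \<open>i < n\<close> \<open>j < n\<close> that unfolding GOE_def
      by (metis carrier_matD index_transpose_mat(1))
    then show ?thesis
      using upper[of j i] False \<open>i < n\<close> by (simp cong: measurable_cong)
  qed (use upper that in auto)
  have "laplacian_mat (A \<omega>) $$ (i, i) = (\<Sum>j<n. A \<omega> $$ (i, j)) - A \<omega> $$ (i, i)"
    if "\<omega> \<in> space M" for \<omega>
    using GOE that \<open>i < n\<close> by (intro laplacian_mat_diag) (auto simp: GOE_def)
  then show ?thesis
    using \<open>i < n\<close> by (simp cong: measurable_cong)
qed

section \<open>Splitting the diagonal into an i.i.d. part and a common shift\<close>

text \<open>The covariance has eigenvalue 1 - 2/n orthogonally to the all-ones vector and 2 - 2/n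
  along it. Shrinking the latter direction to match leaves a multiple of the identity, and n > 2
  makes that multiple positive, so it can be normalised. What is removed is common to all
  coordinates and has variance at most 2/n.\<close>

lemma GOE_laplacian_diag_decomposition:
  assumes GOE: "GOE n M A" and n: "n > 2"
  obtains Z R where
    "\<And>\<omega> i. i < n \<Longrightarrow> laplacian_mat (A \<omega>) $$ (i, i) = sqrt (1 - 2 / real n) * Z i \<omega> + R \<omega>"
    "\<And>i. i < n \<Longrightarrow> Z i \<in> borel_measurable M"
    "R \<in> borel_measurable M"
    "\<And>v. prob {\<omega> \<in> space M. \<forall>i<n. Z i \<omega> \<le> v} = measure std_normal_distribution {..v} ^ n"
    "\<And>\<delta>. \<delta> > 0 \<Longrightarrow> prob {\<omega> \<in> space M. \<delta> \<le> \<bar>R \<omega>\<bar>} \<le> 2 / (real n * \<delta>\<^sup>2)"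
proof -
  define X where "X i \<omega> = laplacian_mat (A \<omega>) $$ (i, i)" for i \<omega>
  define S where "S \<omega> = (\<Sum>i<n. X i \<omega>)" for \<omega>
  define r where "r = sqrt ((real n - 2) / (2 * real n - 2))"
  \<comment> \<open>Subtracting \<open>q S\<close> multiplies the all-ones direction, of variance \<open>2 - 2/n\<close>, by \<open>r = 1 - n q\<close>;
    the result has variance \<open>1 - 2/n\<close>, as in the orthogonal directions.\<close>
  define q where "q = (1 - r) / real n"
  define \<sigma> where "\<sigma> = sqrt (1 - 2 / real n)"
  define R where "R \<omega> = q * S \<omega>" for \<omega>
  define Z where "Z i \<omega> = (X i \<omega> - R \<omega>) / \<sigma>" for i \<omega>
  have r: "r\<^sup>2 = (real n - 2) / (2 * real n - 2)" "0 \<le> r" "r \<le> 1"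
    using n by (auto simp: r_def)
  have \<sigma>: "\<sigma>\<^sup>2 = (real n - 2) / real n" "\<sigma> > 0"
    using n by (auto simp: \<sigma>_def field_simps)
  have char: "expectation (\<lambda>\<omega>. iexp (\<Sum>i<n. s i * X i \<omega>))
    = exp (- ((real n - 2) * (\<Sum>i<n. (s i)\<^sup>2) + (\<Sum>i<n. s i)\<^sup>2) / (2 * real n))" for s
    unfolding X_def using GOE n by (intro expectation_iexp_laplacian_diag) auto
  have X [measurable]: "X i \<in> borel_measurable M" if "i < n" for i
    unfolding X_def using measurable_laplacian_diag[OF GOE that] .
  have S [measurable]: "S \<in> borel_measurable M"
    unfolding S_def by measurable
  have R [measurable]: "R \<in> borel_measurable M"
    unfolding R_def by measurable
  have Z [measurable]: "Z i \<in> borel_measurable M" if "i < n" for i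
    unfolding Z_def using that by measurable
  have charZ: "expectation (\<lambda>\<omega>. iexp (\<Sum>i<n. t i * Z i \<omega>))
    = (\<Prod>i<n. char std_normal_distribution (t i))" for t
  proof -
    define T where "T = (\<Sum>i<n. t i)"
    define U where "U = (\<Sum>i<n. (t i)\<^sup>2)"
    \<comment> \<open>These are the coefficients of the same linear form in terms of X: the map from
      X to Z is the symmetric matrix (I - q J) / \<open>\<sigma>\<close>, so it acts on t in the
      same way.\<close>
    define s where "s i = (t i - q * T) / \<sigma>" for i
    have "(\<Sum>i<n. t i * Z i \<omega>) = (\<Sum>i<n. s i * X i \<omega>)" for \<omega>
    proof -
      have "(\<Sum>i<n. t i * Z i \<omega>) = ((\<Sum>i<n. t i * X i \<omega>) - T * (q * S \<omega>)) / \<sigma>"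
        by (simp add: Z_def R_def T_def sum_divide_distrib[symmetric] right_diff_distrib
            sum_subtractf sum_distrib_right)
      also have "\<dots> = (\<Sum>i<n. s i * X i \<omega>)"
        by (simp add: s_def S_def sum_divide_distrib[symmetric] algebra_simps
            sum_subtractf sum_distrib_left)
      finally show ?thesis .
    qed
    then have "expectation (\<lambda>\<omega>. iexp (\<Sum>i<n. t i * Z i \<omega>))
      = exp (- ((real n - 2) * (\<Sum>i<n. (s i)\<^sup>2) + (\<Sum>i<n. s i)\<^sup>2) / (2 * real n))"
      by (simp only: char)
    also have "(\<Sum>i<n. s i) = r * T / \<sigma>"
    proof -
      have "(\<Sum>i<n. s i) = (T - real n * (q * T)) / \<sigma>"
        by (simp add: s_def T_def sum_divide_distrib[symmetric] sum_subtractf)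
      then show ?thesis using n by (simp add: q_def field_simps)
    qed
    \<comment> \<open>With r = 1 - n q one has 2 q - n q^2 = (1 - r^2) / n.\<close>
    also have "(\<Sum>i<n. (s i)\<^sup>2) = (U - (1 - r\<^sup>2) * T\<^sup>2 / real n) / \<sigma>\<^sup>2"
    proof -
      have "(\<Sum>i<n. (s i)\<^sup>2) = (\<Sum>i<n. (t i)\<^sup>2 - 2 * q * T * t i + (q * T)\<^sup>2) / \<sigma>\<^sup>2"
        by (simp add: s_def power_divide sum_divide_distrib[symmetric] power2_diff algebra_simps)
      also have "(\<Sum>i<n. (t i)\<^sup>2 - 2 * q * T * t i + (q * T)\<^sup>2)
          = U - 2 * q * T * T + real n * (q * T)\<^sup>2"
        by (simp add: sum.distrib sum_subtractf U_def T_def sum_distrib_left[symmetric])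
      also have "\<dots> = U - (1 - r\<^sup>2) * T\<^sup>2 / real n"
        using n by (simp add: q_def field_simps power2_eq_square)
      finally show ?thesis .
    qed
    \<comment> \<open>The terms in T^2 cancel by the choice of r: as n \<open>\<sigma>\<close>^2 = n
      - 2, their sum is -(1 - r^2) + r^2 n / (n - 2) times T^2, which vanishes for r^2 = (n - 2) /
      (2 n - 2).\<close>
    also have "(real n - 2) * ((U - (1 - r\<^sup>2) * T\<^sup>2 / real n) / \<sigma>\<^sup>2) + (r * T / \<sigma>)\<^sup>2 = real n * U"
      using n unfolding power_divide power_mult_distrib r(1) \<sigma>(1)
      by (simp add: divide_simps) (simp add: algebra_simps power2_eq_square)
    also have "- (real n * U) / (2 * real n) = (\<Sum>i<n. - (t i)\<^sup>2 / 2)"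
      using n by (simp add: U_def sum_negf sum_divide_distrib)
    finally show ?thesis
      by (simp add: char_std_normal_distribution exp_sum)
  qed
  have probZ: "prob {\<omega> \<in> space M. \<forall>i<n. Z i \<omega> \<le> v} = measure std_normal_distribution {..v} ^ n" for v
    using prob_prod_if_char_prod[of "{..<n}" Z "\<lambda>_. std_normal_distribution" "\<lambda>_. {..v}"]
      charZ Z real_dist_normal_dist by (auto simp: Ball_def)
  \<comment> \<open>The standard deviation of S: taking all coefficients equal to 1, the variance is
    ((n - 2) n + n^2) / n.\<close>
  define d where "d = sqrt (2 * real n - 2)"
  have d: "d > 0" "d\<^sup>2 = 2 * real n - 2" using n by (auto simp: d_def)
  have "distr M borel (\<lambda>\<omega>. S \<omega> / d) = std_normal_distribution"
  proof (rule Levy_uniqueness)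
    show "real_distribution (distr M borel (\<lambda>\<omega>. S \<omega> / d))"
      by (rule real_distribution_distr) simp
    show "real_distribution std_normal_distribution" by (rule real_dist_normal_dist)
    show "char (distr M borel (\<lambda>\<omega>. S \<omega> / d)) = char std_normal_distribution"
    proof
      fix t
      have sum_const: "(real n - 2) * (\<Sum>i<n. k\<^sup>2) + (\<Sum>i<n. k)\<^sup>2 = real n * (2 * real n - 2) * k\<^sup>2"
        for k by (simp add: power_mult_distrib) (simp add: algebra_simps power2_eq_square)
      have "char (distr M borel (\<lambda>\<omega>. S \<omega> / d)) t = expectation (\<lambda>\<omega>. iexp (\<Sum>i<n. (t / d) * X i \<omega>))"
        unfolding char_def by (subst integral_distr) (auto simp: S_def sum_distrib_left sum_divide_distrib)
      also have "\<dots> = exp (- ((real n - 2) * (\<Sum>i<n. (t / d)\<^sup>2) + (\<Sum>i<n. t / d)\<^sup>2) / (2 * real n))"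
        by (rule char)
      also have "(real n - 2) * (\<Sum>i<n. (t / d)\<^sup>2) + (\<Sum>i<n. t / d)\<^sup>2 = real n * d\<^sup>2 * (t / d)\<^sup>2"
        unfolding d(2) by (rule sum_const)
      also have "- (real n * d\<^sup>2 * (t / d)\<^sup>2) / (2 * real n) = - t\<^sup>2 / 2"
        using d n by (simp add: power_divide)
      finally show "char (distr M borel (\<lambda>\<omega>. S \<omega> / d)) t = char std_normal_distribution t"
        by (simp add: char_std_normal_distribution)
    qed
  qed
  note S_distr = this
  have probR: "prob {\<omega> \<in> space M. \<delta> \<le> \<bar>R \<omega>\<bar>} \<le> 2 / (real n * \<delta>\<^sup>2)" if "\<delta> > 0" for \<delta>
  proof -
    \<comment> \<open>Since 0 <= 1 - r <= 1, the modulus of R is at most that of S divided by n, so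
      a deviation of R by \<open>\<delta>\<close> forces one of S / d by a.\<close>
    define a where "a = \<delta> * real n / d"
    have a: "a > 0" using that n d by (simp add: a_def)
    have "prob {\<omega> \<in> space M. \<delta> \<le> \<bar>R \<omega>\<bar>} \<le> prob {\<omega> \<in> space M. a \<le> \<bar>S \<omega> / d\<bar>}"
    proof (rule finite_measure_mono)
      have "a \<le> \<bar>S \<omega> / d\<bar>" if "\<delta> \<le> \<bar>R \<omega>\<bar>" for \<omega>
      proof -
        have "\<bar>R \<omega>\<bar> = (1 - r) * \<bar>S \<omega>\<bar> / real n"
          using r by (simp add: R_def q_def abs_mult)
        also have "\<dots> \<le> 1 * \<bar>S \<omega>\<bar> / real n"
          using r by (intro divide_right_mono mult_right_mono) auto
        finally have "\<bar>R \<omega>\<bar> * real n \<le> \<bar>S \<omega>\<bar>" using n by (simp add: field_simps)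
        moreover have "\<delta> * real n \<le> \<bar>R \<omega>\<bar> * real n" using that by (rule mult_right_mono) simp
        ultimately have "\<delta> * real n \<le> \<bar>S \<omega>\<bar>" by linarith
        then show ?thesis using d by (simp add: a_def divide_right_mono)
      qed
      then show "{\<omega> \<in> space M. \<delta> \<le> \<bar>R \<omega>\<bar>} \<subseteq> {\<omega> \<in> space M. a \<le> \<bar>S \<omega> / d\<bar>}" by auto
    qed measurable
    also have "\<dots> = measure (distr M borel (\<lambda>\<omega>. S \<omega> / d)) {x. a \<le> \<bar>x\<bar>}"
      by (subst measure_distr) (auto intro!: arg_cong[where f = prob])
    also have "\<dots> \<le> 1 / a\<^sup>2"
      unfolding S_distr by (rule std_normal_chebyshev[OF a])
    also have "\<dots> = (2 * real n - 2) / (real n * real n * \<delta>\<^sup>2)"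
      unfolding a_def power_divide d(2) by (simp add: power_mult_distrib power2_eq_square mult_ac)
    also have "\<dots> \<le> 2 * real n / (real n * real n * \<delta>\<^sup>2)"
      by (intro divide_right_mono) auto
    also have "\<dots> = 2 / (real n * \<delta>\<^sup>2)" using n by simp
    finally show ?thesis .
  qed
  show thesis
  proof (rule that)
    show "laplacian_mat (A \<omega>) $$ (i, i) = sqrt (1 - 2 / real n) * Z i \<omega> + R \<omega>" for \<omega> i
      using \<sigma>(2) unfolding \<sigma>_def[symmetric] X_def[symmetric] Z_def by simp
  qed (use Z R probZ probR in auto)
qed

text \<open>Off the event that the modulus of R reaches \<open>\<delta>\<close>, the shift R moves
  the level by less than \<open>\<delta>\<close> in either direction. A union bound charges the
  exceptional event to the error term, so only the separate laws of Z and R enter.\<close>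

lemma GOE_prob_max_diag_bounds:
  fixes u :: real
  assumes GOE: "GOE n M A" and n: "n > 2" and \<delta>: "\<delta> > 0"
  defines "\<Phi> \<equiv> \<lambda>v. measure std_normal_distribution {..v / sqrt (1 - 2 / real n)}"
    and "E \<equiv> {\<omega> \<in> space M. max_diag (laplacian_mat (A \<omega>)) \<le> u}"
  shows "\<Phi> (u - \<delta>) ^ n - 2 / (real n * \<delta>\<^sup>2) \<le> prob E" "prob E \<le> \<Phi> (u + \<delta>) ^ n + 2 / (real n * \<delta>\<^sup>2)"
proof -
  obtain Z R where
    eq: "\<And>\<omega> i. i < n \<Longrightarrow> laplacian_mat (A \<omega>) $$ (i, i) = sqrt (1 - 2 / real n) * Z i \<omega> + R \<omega>"
    and Z [measurable]: "\<And>i. i < n \<Longrightarrow> Z i \<in> borel_measurable M"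
    and R [measurable]: "R \<in> borel_measurable M"
    and probZ: "\<And>v. prob {\<omega> \<in> space M. \<forall>i<n. Z i \<omega> \<le> v} = measure std_normal_distribution {..v} ^ n"
    and probR: "\<And>\<delta>. \<delta> > 0 \<Longrightarrow> prob {\<omega> \<in> space M. \<delta> \<le> \<bar>R \<omega>\<bar>} \<le> 2 / (real n * \<delta>\<^sup>2)"
    using GOE_laplacian_diag_decomposition[OF GOE n] by blast
  define \<sigma> where "\<sigma> = sqrt (1 - 2 / real n)"
  have \<sigma>: "\<sigma> > 0" using n by (simp add: \<sigma>_def)
  have E: "E = {\<omega> \<in> space M. \<forall>i\<in>{..<n}. \<sigma> * Z i \<omega> + R \<omega> \<le> u}"
    using GOE n unfolding E_def \<sigma>_def
    by (auto simp: GOE_def eq max_diag_laplacian_le_iff)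
  have [measurable]: "E \<in> events"
    unfolding E by measurable
  define F where "F v = {\<omega> \<in> space M. \<forall>i\<in>{..<n}. Z i \<omega> \<le> v / \<sigma>}" for v
  have F [measurable]: "F v \<in> events" for v
    unfolding F_def by measurable
  have probF: "prob (F v) = \<Phi> v ^ n" for v
    using probZ[of "v / \<sigma>"] by (simp add: F_def \<Phi>_def \<sigma>_def Ball_def)
  define G where "G = {\<omega> \<in> space M. \<delta> \<le> \<bar>R \<omega>\<bar>}"
  have [measurable]: "G \<in> events"
    unfolding G_def by measurable
  have probG: "prob G \<le> 2 / (real n * \<delta>\<^sup>2)"
    unfolding G_def by (rule probR[OF \<delta>])
  have "E \<subseteq> F (u + \<delta>) \<union> G"
  proof
    fix \<omega> assume \<omega>: "\<omega> \<in> E"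
    show "\<omega> \<in> F (u + \<delta>) \<union> G"
    proof (cases "\<delta> \<le> \<bar>R \<omega>\<bar>")
      case False
      have "Z i \<omega> \<le> (u + \<delta>) / \<sigma>" if "i < n" for i
      proof -
        have "\<sigma> * Z i \<omega> + R \<omega> \<le> u" using \<omega> that by (auto simp: E)
        with False have "\<sigma> * Z i \<omega> \<le> u + \<delta>" by linarith
        with \<sigma> show ?thesis by (simp add: field_simps)
      qed
      with \<omega> show ?thesis by (auto simp: E F_def)
    qed (use \<omega> in \<open>auto simp: E G_def\<close>)
  qed
  then have "prob E \<le> prob (F (u + \<delta>) \<union> G)"
    by (intro finite_measure_mono) auto
  also have "\<dots> \<le> prob (F (u + \<delta>)) + prob G"
    by (intro measure_Un_le) auto
  finally show "prob E \<le> \<Phi> (u + \<delta>) ^ n + 2 / (real n * \<delta>\<^sup>2)"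
    using probG by (simp add: probF)
  have "F (u - \<delta>) \<subseteq> E \<union> G"
  proof
    fix \<omega> assume \<omega>: "\<omega> \<in> F (u - \<delta>)"
    show "\<omega> \<in> E \<union> G"
    proof (cases "\<delta> \<le> \<bar>R \<omega>\<bar>")
      case False
      have "\<sigma> * Z i \<omega> + R \<omega> \<le> u" if "i < n" for i
      proof -
        have "Z i \<omega> \<le> (u - \<delta>) / \<sigma>" using \<omega> that by (auto simp: F_def)
        with \<sigma> have "\<sigma> * Z i \<omega> \<le> u - \<delta>" by (simp add: field_simps)
        with False show ?thesis by linarith
      qed
      with \<omega> show ?thesis by (auto simp: E F_def)
    qed (use \<omega> in \<open>auto simp: F_def G_def\<close>)
  qed
  then have "prob (F (u - \<delta>)) \<le> prob (E \<union> G)"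
    by (intro finite_measure_mono) auto
  also have "\<dots> \<le> prob E + prob G"
    by (intro measure_Un_le) auto
  finally show "\<Phi> (u - \<delta>) ^ n - 2 / (real n * \<delta>\<^sup>2) \<le> prob E"
    using probG by (simp add: probF)
qed

end

section \<open>Passage to the Gumbel limit\<close>

text \<open>The tail at the level is asymptotic to exp (-x) / n for every s, so the upper and lower
  estimates for the maximum share this limit.\<close>

lemma std_normal_power_perturbed_level:
  "(\<lambda>n. measure std_normal_distribution {..perturbed_level s x n} ^ n) \<longlonglongrightarrow> gumbel_cdf x"
proof -
  interpret real_distribution std_normal_distribution
    by (rule real_dist_normal_dist)
  have "measure std_normal_distribution {..v} = 1 - measure std_normal_distribution {v<..}" for v
    using prob_compl[of "{v<..}"] by (simp add: Compl_eq_Diff_UNIV[symmetric])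
  then show ?thesis
    unfolding gumbel_cdf_def
    using tendsto_one_minus_power[OF _ std_normal_tail_perturbed_level] by simp
qed

theorem theoremA1:
  fixes M :: "nat \<Rightarrow> 'a measure" and A :: "nat \<Rightarrow> 'a \<Rightarrow> real mat"
  assumes "\<And>n. n \<ge> 1 \<Longrightarrow> GOE n (M n) (A n)"
  shows "weak_conv_m
           (\<lambda>n. distr (M n) borel
              (\<lambda>\<omega>. scale_a n * (max_diag (laplacian_mat (A n \<omega>)) - centre_b' n)))
           gumbel_distribution"
  unfolding weak_conv_m_def weak_conv_def cdf_gumbel_distribution
proof (intro allI impI)
  fix x :: real
  let ?\<Phi> = "\<lambda>s n. measure std_normal_distribution {..perturbed_level s x n} ^ n"
  let ?F = "\<lambda>n. cdf (distr (M n) borel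
    (\<lambda>\<omega>. scale_a n * (max_diag (laplacian_mat (A n \<omega>)) - centre_b' n))) x"
  have bounds: "?\<Phi> (- 1) n - 2 / sqrt (real n) \<le> ?F n \<and> ?F n \<le> ?\<Phi> 1 n + 2 / sqrt (real n)"
    if n: "n > 2" for n
  proof -
    have GOE: "GOE n (M n) (A n)" using assms n by simp
    interpret prob_space "M n" using GOE by (simp add: GOE_def)
    define u where "u = centre_b' n + x / scale_a n"
    \<comment> \<open>This choice makes n \<open>\<delta>\<close>^2 = sqrt n, so the Chebyshev error
      vanishes, while \<open>\<delta>\<close> times a_n still tends to 0.\<close>
    define \<delta> where "\<delta> = real n powr (- 1 / 4)"
    have a: "scale_a n > 0" using n by (simp add: scale_a_def)
    have \<delta>: "\<delta> > 0" using n by (simp add: \<delta>_def)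
    have "real n * \<delta>\<^sup>2 = sqrt (real n)"
      using n by (simp add: \<delta>_def power2_eq_square powr_add[symmetric] powr_mult_base powr_half_sqrt)
    note bounds = GOE_prob_max_diag_bounds[OF GOE n \<delta>, of u, unfolded this]
    have [measurable]: "(\<lambda>\<omega>. laplacian_mat (A n \<omega>) $$ (i, i)) \<in> borel_measurable (M n)" if "i < n" for i
      using measurable_laplacian_diag[OF GOE that] .
    have "(\<lambda>\<omega>. Max ((\<lambda>i. laplacian_mat (A n \<omega>) $$ (i, i)) ` {..<n})) \<in> borel_measurable (M n)"
      by measurable
    \<comment> \<open>The index range in \<open>max_diag\<close> is the row dimension of the matrix,
      which is known to be n only on the space of the measure; hence the pointwise rewriting before
      measurability is concluded.\<close>
    moreover have "max_diag (laplacian_mat (A n \<omega>)) = Max ((\<lambda>i. laplacian_mat (A n \<omega>) $$ (i, i)) ` {..<n})"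
      if "\<omega> \<in> space (M n)" for \<omega>
    proof -
      have "A n \<omega> \<in> carrier_mat n n" using GOE that by (simp add: GOE_def)
      then show ?thesis by (auto simp: max_diag_def laplacian_mat_def)
    qed
    ultimately have [measurable]: "(\<lambda>\<omega>. max_diag (laplacian_mat (A n \<omega>))) \<in> borel_measurable (M n)"
      by (simp cong: measurable_cong)
    \<comment> \<open>Because a_n > 0, the rescaled maximum is at most x exactly when the maximum
      itself is at most u.\<close>
    have "?F n = prob {\<omega> \<in> space (M n). max_diag (laplacian_mat (A n \<omega>)) \<le> u}"
      unfolding cdf_def u_def using a
      by (subst measure_distr) (auto intro!: arg_cong[where f = prob] simp: field_simps)
    with bounds show ?thesis
      by (simp add: perturbed_level_def u_def \<delta>_def)
  qed
  have err: "(\<lambda>n. 2 / sqrt (real n)) \<longlonglongrightarrow> 0" by real_asymp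
  show "?F \<longlonglongrightarrow> gumbel_cdf x"
  proof (rule tendsto_sandwich)
    show "(\<lambda>n. ?\<Phi> (- 1) n - 2 / sqrt (real n)) \<longlonglongrightarrow> gumbel_cdf x"
      using tendsto_diff[OF std_normal_power_perturbed_level err] by simp
    show "(\<lambda>n. ?\<Phi> 1 n + 2 / sqrt (real n)) \<longlonglongrightarrow> gumbel_cdf x"
      using tendsto_add[OF std_normal_power_perturbed_level err] by simp
  qed (use bounds in \<open>auto intro: eventually_mono[OF eventually_gt_at_top[of 2]]\<close>)
qed

end
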